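(* Let $K > 1$ be a real number, and let $\theta^*$ denote the largest (supremum of the) exponent $\theta$ such that there is a constant $c(K) > 0$ for which there exist arbitrarily large finite sets $A, B \subset \mathbb{Z}$ satisfying \[ |A + B| \le K|A| \quad \text{and} \quad |A - B| \ge c(K)\, |A + B|^{\theta}. \] Then $\theta^* \ge 1.173077$.
   Context: For finite sets $A, B \subset \mathbb{Z}$, $A + B = \{a + b : a \in A, b \in B\}$ and $A - B = \{a - b : a \in A, b \in B\}$; $|\cdot|$ denotes cardinality. This is the "sums and differences of sets" problem posed by Gyarmati, Hennecart and Ruzsa. *)

theory Defs
  imports Complex_Main "HOL-Library.Set_Algebras"
begin

text \<open>
  The sumset is the operation \<open>A + B\<close> of \<^theory>\<open>HOL-Library.Set_Algebras\<close>. The difference set needs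
  a name of its own, since \<open>A - B\<close> on sets denotes the relative complement.
\<close>

definition diffset :: "int set \<Rightarrow> int set \<Rightarrow> int set"
  where "diffset A B = {a - b | a b. a \<in> A \<and> b \<in> B}"

text \<open>
  The constant \<open>c\<close> may depend on \<open>K\<close> and \<open>\<theta>\<close>, but not on the sets. Both \<open>A\<close> and \<open>B\<close> are required to
  be arbitrarily large.
\<close>

definition admissible_exponent :: "real \<Rightarrow> real \<Rightarrow> bool"
  where "admissible_exponent K \<theta> \<longleftrightarrow>
    (\<exists>c>0. \<forall>N. \<exists>A B :: int set.
       finite A \<and> finite B \<and> N \<le> card A \<and> N \<le> card B \<and>
       real (card (A + B)) \<le> K * real (card A) \<and>
       real (card (diffset A B)) \<ge> c * real (card (A + B)) powr \<theta>)"

text \<open>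
  The supremum is that of a set bounded above by 2, because
  \<open>card (diffset A B) \<le> card A * card B \<le> (card (A + B))\<^sup>2\<close> for finite nonempty \<open>A\<close> and \<open>B\<close>.
\<close>

definition theta_star :: "real \<Rightarrow> real"
  where "theta_star K = Sup {\<theta>. admissible_exponent K \<theta>}"

end

theory Submission
  imports Defs "HOL-Analysis.Harmonic_Numbers" "HOL-Real_Asymp.Real_Asymp"
begin

text \<open>
  Let \<open>X\<close> and \<open>Y\<close> consist of the integers with \<open>n\<close> digits from \<open>{0..L}\<close> in base \<open>2 L + 1\<close> and with digit
  sum \<open>a\<close> and \<open>b\<close>, respectively. For \<open>r > 0\<close>, the generating function bound gives
  \<open>|X + Y| r\<^sup>a\<^sup>+\<^sup>b \<le> (1 + r + \<dots> + r\<^sup>2\<^sup>L)\<^sup>n\<close>. On the other hand, the words over \<open>{-L..L}\<close> with positive part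
  summing to \<open>a\<close> and negative part summing to \<open>b\<close> represent distinct elements of \<open>X - Y\<close>, and by
  pigeonhole \<open>a\<close> and \<open>b\<close> can be chosen such that their number times \<open>r\<^sup>a\<^sup>+\<^sup>b\<close> is at least
  \<open>(1 + 2 r + \<dots> + 2 r\<^sup>L)\<^sup>n\<close> up to a factor polynomial in \<open>n\<close>.

  Write \<open>m = (2 L + 1)\<^sup>n\<close>. Taking for \<open>A\<close> an interval of length a large multiple of \<open>m\<close> together with
  \<open>m / |X + Y|\<close> widely spaced translates of \<open>X\<close>, and \<open>B = Y\<close>, one gets \<open>|A + B| \<le> K |A|\<close>,
  \<open>|A + B| = O(m)\<close> and \<open>|A - B| \<ge> m |X - Y| / |X + Y|\<close>. So every \<open>\<theta> > 1\<close> with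
  \<open>(2 L + 1)\<^sup>\<theta>\<^sup>-\<^sup>1 < (1 + 2 r + \<dots> + 2 r\<^sup>L) / (1 + r + \<dots> + r\<^sup>2\<^sup>L)\<close> is admissible. For \<open>L = 5\<close> the right-hand side
  is largest near \<open>r = 0.62605\<close>; the proof uses \<open>r = 62 / 99\<close>.
\<close>

section \<open>Admissible exponents\<close>

lemma diffset_eq_image: "diffset A B = (\<lambda>(a, b). a - b) ` (A \<times> B)"
  by (auto simp: diffset_def)

lemma finite_diffset: "finite A \<Longrightarrow> finite B \<Longrightarrow> finite (diffset A B)"
  by (simp add: diffset_eq_image)

lemma card_diffset_le: "finite A \<Longrightarrow> finite B \<Longrightarrow> card (diffset A B) \<le> card A * card B"
  unfolding diffset_eq_image by (metis card_cartesian_product card_image_le finite_cartesian_product)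

lemma card_le_of_subset_interval: "A \<subseteq> {0..<int n} \<Longrightarrow> card A \<le> n"
  using card_mono[of "{0..<int n}" A] by simp

lemma card_le_card_set_plus:
  fixes A B :: "int set"
  assumes "finite A" "finite B" "B \<noteq> {}"
  shows "card A \<le> card (A + B)"
proof -
  obtain b where "b \<in> B" using assms by auto
  then have "(\<lambda>a. a + b) ` A \<subseteq> A + B" by (auto simp: set_plus_def)
  moreover have "finite (A + B)" using assms by (simp add: finite_set_plus)
  ultimately have "card ((\<lambda>a. a + b) ` A) \<le> card (A + B)" by (rule card_mono[rotated])
  then show ?thesis by (simp add: card_image)
qed

text \<open>\<open>Sup\<close> on the reals dominates the members of a set only if that set is
  bounded above. With \<open>s = |A + B|\<close>, one has
  \<open>c * s powr \<theta> \<le> |A| * |B| \<le> s\<^sup>2\<close>, which fails for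
  \<open>\<theta> > 2\<close> once \<open>s\<close> is large.\<close>

lemma admissible_exponent_le_2:
  assumes "admissible_exponent K \<theta>"
  shows "\<theta> \<le> 2"
proof (rule ccontr)
  assume "\<not> \<theta> \<le> 2"
  then have \<theta>: "\<theta> > 2" by simp
  obtain c where c: "c > 0" and ex: "\<And>N. \<exists>A B :: int set.
       finite A \<and> finite B \<and> N \<le> card A \<and> N \<le> card B \<and>
       real (card (diffset A B)) \<ge> c * real (card (A + B)) powr \<theta>"
    using assms unfolding admissible_exponent_def by metis
  have "filterlim (\<lambda>n. c * real n powr (\<theta> - 2)) at_top sequentially"
    using c \<theta> by real_asymp
  then have "eventually (\<lambda>n. c * real n powr (\<theta> - 2) > 1) sequentially"
    by (simp add: filterlim_at_top_dense)
  then obtain N where N: "\<And>n. n \<ge> N \<Longrightarrow> c * real n powr (\<theta> - 2) > 1"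
    by (auto simp: eventually_sequentially)
  obtain A B :: "int set" where AB: "finite A" "finite B" "N + 1 \<le> card A" "N + 1 \<le> card B"
      "real (card (diffset A B)) \<ge> c * real (card (A + B)) powr \<theta>"
    using ex[of "N + 1"] by auto
  define s where "s = real (card (A + B))"
  have "A \<noteq> {}" "B \<noteq> {}" using AB by auto
  have sA: "real (card A) \<le> s"
    unfolding s_def using card_le_card_set_plus[OF AB(1,2) \<open>B \<noteq> {}\<close>] by simp
  have sB: "real (card B) \<le> s"
    unfolding s_def using card_le_card_set_plus[OF AB(2,1) \<open>A \<noteq> {}\<close>] by (simp add: add.commute)
  have s: "s > 0" using sA AB by simp
  have "card (A + B) \<ge> N" using sA AB unfolding s_def by linarith
  then have "c * s powr (\<theta> - 2) > 1" using N unfolding s_def by simp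
  then have "c * s powr (\<theta> - 2) * s ^ 2 > 1 * s ^ 2"
    using s by (intro mult_strict_right_mono) auto
  also have "c * s powr (\<theta> - 2) * s ^ 2 = c * s powr \<theta>"
    using s by (simp add: powr_diff flip: powr_numeral)
  also have "\<dots> \<le> real (card (diffset A B))" using AB by (simp add: s_def)
  also have "\<dots> \<le> real (card A) * real (card B)"
    using card_diffset_le[OF AB(1,2)] by (metis of_nat_le_iff of_nat_mult)
  also have "\<dots> \<le> s ^ 2"
    unfolding power2_eq_square using sA sB s by (intro mult_mono) auto
  finally show False by simp
qed

lemma le_theta_star:
  assumes "admissible_exponent K \<theta>"
  shows "\<theta> \<le> theta_star K"
  unfolding theta_star_def
  using assms admissible_exponent_le_2 by (intro cSup_upper bdd_aboveI[of _ 2]) auto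

section \<open>From a pair \<open>X\<close>, \<open>Y\<close> in \<open>[0, m)\<close> to admissible
  sets\<close>

text \<open>Differences of \<open>X\<close> and \<open>Y\<close> lie strictly between
  \<open>-m\<close> and \<open>m\<close>, so shifts by distinct multiples of \<open>2 * m\<close>
  are disjoint.\<close>

lemma card_diffset_translates:
  fixes X Y :: "int set" and m :: int and t :: nat
  assumes "X \<subseteq> {0..<m}" "Y \<subseteq> {0..<m}"
  shows "card (diffset (\<Union>s<t. (+) (2 * m * int s) ` X) Y) = t * card (diffset X Y)"
proof -
  let ?f = "\<lambda>(s, d). 2 * m * int s + d"
  have bound: "\<bar>d\<bar> < m" if "d \<in> diffset X Y" for d
    using that assms by (force simp: diffset_def)
  have "inj_on ?f ({..<t} \<times> diffset X Y)"
  proof (rule inj_onI, clarify)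
    fix s d s' d'
    assume d: "d \<in> diffset X Y" "d' \<in> diffset X Y"
      and eq: "2 * m * int s + d = 2 * m * int s' + d'"
    have "d' - d = 2 * m * (int s - int s')" using eq by (simp add: algebra_simps)
    then have "2 * m dvd d' - d" by simp
    moreover have "\<bar>d' - d\<bar> < 2 * m" using bound d by (smt (verit))
    ultimately have "d' - d = 0" using dvd_imp_le_int[of "d' - d" "2 * m"] by fastforce
    moreover have "m > 0" using bound[OF d(1)] by linarith
    ultimately show "s = s' \<and> d = d'" using eq by simp
  qed
  moreover have "diffset (\<Union>s<t. (+) (2 * m * int s) ` X) Y = ?f ` ({..<t} \<times> diffset X Y)"
  proof (intro equalityI subsetI)
    fix z assume "z \<in> diffset (\<Union>s<t. (+) (2 * m * int s) ` X) Y"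
    then obtain s x y where "s < t" "x \<in> X" "y \<in> Y" "z = 2 * m * int s + (x - y)"
      by (auto simp: diffset_def)
    then show "z \<in> ?f ` ({..<t} \<times> diffset X Y)"
      by (intro image_eqI[of _ _ "(s, x - y)"]) (auto simp: diffset_def)
  next
    fix z assume "z \<in> ?f ` ({..<t} \<times> diffset X Y)"
    then obtain s x y where sxy: "s < t" "x \<in> X" "y \<in> Y" "z = 2 * m * int s + x - y"
      by (auto simp: diffset_def)
    then have "2 * m * int s + x \<in> (\<Union>s<t. (+) (2 * m * int s) ` X)" by auto
    with sxy show "z \<in> diffset (\<Union>s<t. (+) (2 * m * int s) ` X) Y"
      unfolding diffset_def by blast
  qed
  ultimately show ?thesis by (simp add: card_image card_cartesian_product)
qed

text \<open>
  With about \<open>m / |X + Y|\<close> translates, the sumset of the translates has size comparable to \<open>m\<close>, so it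
  is absorbed by that of a long interval.
\<close>

lemma interval_with_translates:
  fixes X Y :: "int set" and m C :: nat
  assumes K: "K > 1" and C: "real C \<ge> 4 / (K - 1)"
    and m: "m > 0" and sub: "X \<subseteq> {0..<int m}" "Y \<subseteq> {0..<int m}" and ne: "X \<noteq> {}" "Y \<noteq> {}"
  obtains A :: "int set" where "finite A" "C * m \<le> card A"
    "card (A + Y) \<le> (C + 4) * m" "real (card (A + Y)) \<le> K * real (card A)"
    "real m * real (card (diffset X Y)) \<le> real (card (diffset A Y)) * real (card (X + Y))"
proof -
  define S where "S = card (X + Y)"
  \<comment> \<open>Rounding up gives \<open>m \<le> t * S \<le> m + S\<close>, and
    \<open>S \<le> 2 * m\<close> caps this at \<open>3 * m\<close>.\<close>
  define t where "t = m div S + 1"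
  define P where "P = (\<Union>s<t. (+) (2 * int m * int s) ` X)"
  define T where "T = {0..<int (C * m)}"
  have fin: "finite X" "finite Y" using sub finite_subset by blast+
  then have finP: "finite P" by (simp add: P_def)
  have finT: "finite T" by (simp add: T_def)
  have XY: "X + Y \<noteq> {}" using ne by (auto simp: set_plus_def)
  have finXY: "finite (X + Y)" using fin by (simp add: finite_set_plus)
  have S0: "S > 0" using XY finXY by (simp add: S_def card_gt_0_iff)
  have "X + Y \<subseteq> {0..<int (2 * m)}" using sub by (force simp: set_plus_def)
  then have S2: "S \<le> 2 * m" unfolding S_def by (rule card_le_of_subset_interval)
  have "t * S + m mod S = m + S" using div_mult_mod_eq[of m S] by (simp add: t_def)
  moreover have "m mod S < S" using S0 by simp
  ultimately have tS: "t * S \<le> 3 * m" and mt: "m \<le> t * S" using S2 by linarith+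
  have PY: "card (P + Y) \<le> t * S"
  proof -
    have "P + Y \<subseteq> (\<Union>s<t. (+) (2 * int m * int s) ` (X + Y))"
    proof
      fix z assume "z \<in> P + Y"
      then obtain s x y where "s < t" "x \<in> X" "y \<in> Y" "z = 2 * int m * int s + (x + y)"
        by (auto simp: P_def set_plus_def add.assoc)
      then show "z \<in> (\<Union>s<t. (+) (2 * int m * int s) ` (X + Y))" by blast
    qed
    then have "card (P + Y) \<le> card (\<Union>s<t. (+) (2 * int m * int s) ` (X + Y))"
      using finXY by (intro card_mono) auto
    also have "\<dots> \<le> (\<Sum>s<t. card ((+) (2 * int m * int s) ` (X + Y)))"
      by (rule card_UN_le) simp
    also have "\<dots> = t * S" by (simp add: S_def card_image)
    finally show ?thesis .
  qed
  have TY: "card (T + Y) \<le> (C + 1) * m"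
  proof -
    have "T + Y \<subseteq> {0..<int ((C + 1) * m)}"
      using sub(2) by (force simp: set_plus_def T_def algebra_simps)
    then show ?thesis by (rule card_le_of_subset_interval)
  qed
  have "(T \<union> P) + Y = (T + Y) \<union> (P + Y)" by (auto simp: set_plus_def)
  then have "card ((T \<union> P) + Y) \<le> card (T + Y) + card (P + Y)" by (simp add: card_Un_le)
  also have "\<dots> \<le> (C + 4) * m" using TY PY tS by (simp add: algebra_simps)
  finally have sum: "card ((T \<union> P) + Y) \<le> (C + 4) * m" .
  have A: "C * m \<le> card (T \<union> P)"
  proof -
    have "card T = C * m" by (simp only: T_def card_atLeastLessThan_int diff_zero nat_int)
    then show ?thesis using card_mono[of "T \<union> P" T] finT finP by simp
  qed
  show thesis
  proof (rule that[of "T \<union> P"])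
    show "finite (T \<union> P)" using finT finP by simp
    show "C * m \<le> card (T \<union> P)" by (fact A)
    show "card ((T \<union> P) + Y) \<le> (C + 4) * m" by (fact sum)
    \<comment> \<open>This is where \<open>4 / (K - 1)\<close> comes from: the inequality is
      equivalent to \<open>C \<ge> 4 / (K - 1)\<close>.\<close>
    have "real C + 4 \<le> K * real C" using C K by (simp add: field_simps)
    then have "(real C + 4) * real m \<le> K * real C * real m" by (intro mult_right_mono) auto
    also have "\<dots> = K * real (C * m)" by simp
    also have "\<dots> \<le> K * real (card (T \<union> P))"
      using A K by (intro mult_left_mono) (auto simp del: of_nat_mult)
    finally have "(real C + 4) * real m \<le> K * real (card (T \<union> P))" .
    moreover have "real (card ((T \<union> P) + Y)) \<le> real ((C + 4) * m)"
      using sum by (simp del: of_nat_mult of_nat_add)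
    ultimately show "real (card ((T \<union> P) + Y)) \<le> K * real (card (T \<union> P))" by simp
    have "t * card (diffset X Y) = card (diffset P Y)"
      unfolding P_def using card_diffset_translates[OF sub] by simp
    also have "\<dots> \<le> card (diffset (T \<union> P) Y)"
      using finT finP fin by (intro card_mono finite_diffset) (auto simp: diffset_def)
    finally have tD: "t * card (diffset X Y) \<le> card (diffset (T \<union> P) Y)" .
    have "m * card (diffset X Y) \<le> t * S * card (diffset X Y)"
      using mt by (intro mult_le_mono1)
    also have "\<dots> = t * card (diffset X Y) * S" by simp
    also have "\<dots> \<le> card (diffset (T \<union> P) Y) * S" using tD by (intro mult_le_mono1)
    finally have "m * card (diffset X Y) \<le> card (diffset (T \<union> P) Y) * S" .
    then show "real m * real (card (diffset X Y)) \<le>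
        real (card (diffset (T \<union> P) Y)) * real (card (X + Y))"
      unfolding S_def by (metis of_nat_le_iff of_nat_mult)
  qed
qed

text \<open>Adding the interval and translates turns a gain of \<open>m powr (\<theta> - 1)\<close>
  in \<open>|X - Y|\<close> over \<open>|X + Y|\<close> into
  \<open>|A - Y| \<ge> m powr \<theta>\<close>, while \<open>|A + Y| \<le> (C + 4) * m\<close>.
  Hence \<open>c = (C + 4) powr (- \<theta>)\<close> works, and it depends only on \<open>K\<close>
  and \<open>\<theta>\<close>.\<close>

lemma admissible_exponentI:
  fixes \<theta> :: real
  assumes K: "K > 1" and \<theta>: "\<theta> > 1"
    and ex: "\<And>N. \<exists>m\<ge>N. \<exists>X Y. X \<subseteq> {0..<int m} \<and> Y \<subseteq> {0..<int m} \<and> X \<noteq> {} \<and> Y \<noteq> {} \<and>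
      real (card (X + Y)) * real m powr (\<theta> - 1) \<le> real (card (diffset X Y))"
  shows "admissible_exponent K \<theta>"
proof -
  define C where "C = nat \<lceil>4 / (K - 1)\<rceil> + 1"
  have C: "real C \<ge> 4 / (K - 1)" "C \<ge> 1" unfolding C_def by linarith+
  define c where "c = 1 / real (C + 4) powr \<theta>"
  have "\<exists>A B :: int set. finite A \<and> finite B \<and> N \<le> card A \<and> N \<le> card B \<and>
       real (card (A + B)) \<le> K * real (card A) \<and>
       real (card (diffset A B)) \<ge> c * real (card (A + B)) powr \<theta>" for N
  proof -
    have "filterlim (\<lambda>n. real n powr (\<theta> - 1)) at_top sequentially" using \<theta> by real_asymp
    then have "eventually (\<lambda>n. real n powr (\<theta> - 1) \<ge> real N) sequentially"
      by (simp add: filterlim_at_top)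
    then obtain N' where N': "\<And>n. n \<ge> N' \<Longrightarrow> real n powr (\<theta> - 1) \<ge> real N"
      by (auto simp: eventually_sequentially)
    obtain m X Y where mN: "m \<ge> max (max N N') 1"
      and XY: "X \<subseteq> {0..<int m}" "Y \<subseteq> {0..<int m}" "X \<noteq> {}" "Y \<noteq> {}"
      and D: "real (card (X + Y)) * real m powr (\<theta> - 1) \<le> real (card (diffset X Y))"
      using ex[of "max (max N N') 1"] by (elim exE conjE) (rule that)
    have m: "m > 0" using mN by simp
    have fin: "finite X" "finite Y" using XY finite_subset by blast+
    obtain A where A: "finite A" "C * m \<le> card A"
      "card (A + Y) \<le> (C + 4) * m" "real (card (A + Y)) \<le> K * real (card A)"
      "real m * real (card (diffset X Y)) \<le> real (card (diffset A Y)) * real (card (X + Y))"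
      by (rule interval_with_translates[OF K C(1) m XY])
    have S: "card (X + Y) > 0"
      using card_le_card_set_plus[OF fin XY(4)] XY(3) fin by (metis card_gt_0_iff gr_zeroI leD)
    have "m \<le> C * m" using C(2) by simp
    then have NA: "N \<le> card A" using A(2) mN by linarith
    \<comment> \<open>\<open>Y\<close> is not enlarged, so its size has to come from the hypothesis:
      \<open>|X - Y| \<le> |X| * |Y|\<close> forces \<open>|Y| \<ge> m powr (\<theta> - 1)\<close>,
      which is unbounded as \<open>\<theta> > 1\<close>.\<close>
    have "real (card X) * real m powr (\<theta> - 1) \<le> real (card (X + Y)) * real m powr (\<theta> - 1)"
      using card_le_card_set_plus[OF fin XY(4)] by (intro mult_right_mono) auto
    also have "\<dots> \<le> real (card X) * real (card Y)"
      using D card_diffset_le[OF fin] by (metis of_nat_le_iff of_nat_mult order_trans)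
    finally have "real m powr (\<theta> - 1) \<le> real (card Y)"
      using XY(3) fin by (simp add: card_gt_0_iff)
    then have NY: "N \<le> card Y" using N'[of m] mN by simp
    have "real m * (real (card (X + Y)) * real m powr (\<theta> - 1))
        \<le> real m * real (card (diffset X Y))"
      using D by (intro mult_left_mono) auto
    also note A(5)
    finally have mD: "real m * real m powr (\<theta> - 1) \<le> real (card (diffset A Y))"
      using S by (simp add: mult_ac)
    have "real (card (A + Y)) \<le> real (C + 4) * real m"
      using of_nat_mono[OF A(3), where 'a = real] by (simp only: of_nat_mult)
    then have "c * real (card (A + Y)) powr \<theta> \<le> c * (real (C + 4) * real m) powr \<theta>"
      using \<theta> by (intro mult_left_mono powr_mono2) (auto simp: c_def)
    also have "\<dots> = real m powr \<theta>" by (subst powr_mult) (auto simp: c_def)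
    also have "\<dots> = real m * real m powr (\<theta> - 1)" using m by (simp add: powr_diff)
    also note mD
    finally show ?thesis using A(1,4) fin(2) NA NY by blast
  qed
  moreover have "c > 0" by (simp add: c_def)
  ultimately show ?thesis unfolding admissible_exponent_def by blast
qed

section \<open>Words over a finite alphabet\<close>

definition words :: "nat \<Rightarrow> 'a set \<Rightarrow> 'a list set"
  where "words n A = {xs. set xs \<subseteq> A \<and> length xs = n}"

lemma finite_words: "finite A \<Longrightarrow> finite (words n A)"
  by (simp add: words_def finite_lists_length_eq)

text \<open>The weight \<open>r ^ g a\<close> is multiplicative over letters, so each further letter
  contributes one more factor.\<close>

lemma sum_power_weight_words:
  fixes r :: real and g :: "'a \<Rightarrow> nat"
  assumes "finite A"
  shows "(\<Sum>xs\<in>words n A. r ^ (\<Sum>x\<leftarrow>xs. g x)) = (\<Sum>a\<in>A. r ^ g a) ^ n"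
proof (induction n)
  case 0
  have "words 0 A = {[]}" by (auto simp: words_def)
  then show ?case by simp
next
  case (Suc n)
  have "(\<Sum>xs\<in>words (Suc n) A. r ^ (\<Sum>x\<leftarrow>xs. g x)) =
      (\<Sum>(xs, a)\<in>words n A \<times> A. r ^ (\<Sum>x\<leftarrow>xs. g x) * r ^ g a)"
    unfolding words_def lists_length_Suc_eq
    by (subst sum.reindex) (auto simp: inj_on_def power_add mult.commute intro!: sum.cong)
  also have "\<dots> = (\<Sum>xs\<in>words n A. r ^ (\<Sum>x\<leftarrow>xs. g x)) * (\<Sum>a\<in>A. r ^ g a)"
    by (simp add: sum_product sum.cartesian_product)
  finally show ?case using Suc by simp
qed

lemma card_words_weight_le:
  fixes r :: real and g :: "'a \<Rightarrow> nat"
  assumes "finite A" "r \<ge> 0"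
  shows "real (card {xs \<in> words n A. (\<Sum>x\<leftarrow>xs. g x) = k}) * r ^ k \<le> (\<Sum>a\<in>A. r ^ g a) ^ n"
proof -
  let ?U = "{xs \<in> words n A. (\<Sum>x\<leftarrow>xs. g x) = k}"
  have "real (card ?U) * r ^ k = (\<Sum>xs\<in>?U. r ^ (\<Sum>x\<leftarrow>xs. g x))" by simp
  also have "\<dots> \<le> (\<Sum>xs\<in>words n A. r ^ (\<Sum>x\<leftarrow>xs. g x))"
    using assms by (intro sum_mono2) (auto simp: finite_words)
  finally show ?thesis using assms by (simp add: sum_power_weight_words)
qed

lemma sum_list_nat_add:
  fixes xs ys :: "int list"
  assumes "length xs = length ys" "\<forall>x\<in>set xs. x \<ge> 0" "\<forall>y\<in>set ys. y \<ge> 0"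
  shows "(\<Sum>z\<leftarrow>map2 (+) xs ys. nat z) = (\<Sum>x\<leftarrow>xs. nat x) + (\<Sum>y\<leftarrow>ys. nat y)"
  using assms by (induction xs ys rule: list_induct2) (auto simp: nat_add_distrib)

lemma sum_list_nat_abs:
  "(\<Sum>w\<leftarrow>ws. nat \<bar>w\<bar>) = (\<Sum>w\<leftarrow>ws. nat w) + (\<Sum>w\<leftarrow>ws. nat (- w))"
  by (induction ws) auto

text \<open>Confines the pair of digit sums to a square of side \<open>n * L + 1\<close> for the
  pigeonhole argument.\<close>

lemma sum_list_nat_le:
  assumes "set ws \<subseteq> {- int L..int L}"
  shows "(\<Sum>w\<leftarrow>ws. nat w) \<le> length ws * L" "(\<Sum>w\<leftarrow>ws. nat (- w)) \<le> length ws * L"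
  using assms by (induction ws) auto

section \<open>Digit expansions\<close>

text \<open>The head of the list is the least significant digit; digits may be negative.\<close>

abbreviation digit_value :: "int \<Rightarrow> int list \<Rightarrow> int"
  where "digit_value \<equiv> horner_sum (\<lambda>x. x)"

lemma digit_value_add:
  "length xs = length ys \<Longrightarrow>
    digit_value b (map2 (+) xs ys) = digit_value b xs + digit_value b ys"
  by (induction xs ys rule: list_induct2) (auto simp: algebra_simps)

lemma digit_value_diff_parts:
  "digit_value b (map (max 0) ws) - digit_value b (map (\<lambda>w. max 0 (- w)) ws) = digit_value b ws"
  by (induction ws) (auto simp: algebra_simps max_def)

lemma digit_value_bounds:
  assumes "set xs \<subseteq> {0..<b}"
  shows "0 \<le> digit_value b xs \<and> digit_value b xs < b ^ length xs"
  using assms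
proof (induction xs)
  case (Cons x xs)
  then have IH: "0 \<le> digit_value b xs" "digit_value b xs + 1 \<le> b ^ length xs" and x: "0 \<le> x" "x < b"
    by auto
  have "b * (digit_value b xs + 1) \<le> b * b ^ length xs" using IH x by (intro mult_left_mono) auto
  then show ?case using IH x by (auto simp: algebra_simps)
qed simp

text \<open>The digits \<open>-L..L\<close> form a complete residue system modulo the base, so the
  value modulo the base determines the first digit; the remaining ones follow by induction.\<close>

lemma inj_on_digit_value: "inj_on (digit_value (2 * int L + 1)) (words n {- int L..int L})"
proof -
  let ?b = "2 * int L + 1"
  have "xs = ys"
    if "length xs = length ys" "set xs \<subseteq> {- int L..int L}" "set ys \<subseteq> {- int L..int L}"
      "digit_value ?b xs = digit_value ?b ys" for xs ys
    using that
  proof (induction xs ys rule: list_induct2)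
    case (Cons x xs y ys)
    have "y - x = ?b * (digit_value ?b xs - digit_value ?b ys)"
      using Cons.prems by (simp add: algebra_simps)
    then have "?b dvd y - x" by simp
    moreover have "\<bar>y - x\<bar> < ?b" using Cons.prems by auto
    ultimately have "y - x = 0" using dvd_imp_le_int[of "y - x" ?b] by fastforce
    then show ?case using Cons by auto
  qed simp
  then show ?thesis unfolding words_def by (intro inj_onI) auto
qed

section \<open>Sums and differences of sets with prescribed digit sum\<close>

text \<open>In base \<open>2 * L + 1\<close>, sums of two digits up to \<open>L\<close> cause no
  carry and their differences are balanced digits.\<close>

definition digit_sum_set :: "nat \<Rightarrow> nat \<Rightarrow> nat \<Rightarrow> int set"
  where "digit_sum_set L n a =
    digit_value (2 * int L + 1) ` {xs \<in> words n {0..int L}. (\<Sum>x\<leftarrow>xs. nat x) = a}"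

lemma digit_sum_set_subset: "digit_sum_set L n a \<subseteq> {0..<int ((2 * L + 1) ^ n)}"
proof -
  have "digit_value (2 * int L + 1) xs \<in> {0..<int ((2 * L + 1) ^ n)}"
    if "xs \<in> words n {0..int L}" for xs
  proof -
    have "set xs \<subseteq> {0..<2 * int L + 1}" "length xs = n" using that by (auto simp: words_def)
    then show ?thesis using digit_value_bounds[of xs "2 * int L + 1"] by (simp add: add.commute)
  qed
  then show ?thesis by (auto simp: digit_sum_set_def)
qed

text \<open>Digitwise addition produces words over \<open>{0..2 * L}\<close> of weight exactly
  \<open>a + b\<close>, to which \<open>card_words_weight_le\<close> applies.\<close>

lemma card_digit_sum_set_plus:
  fixes r :: real
  assumes "r \<ge> 0"
  shows "real (card (digit_sum_set L n a + digit_sum_set L n b)) * r ^ (a + b)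
    \<le> (\<Sum>j=0..2*L. r ^ j) ^ n"
proof -
  let ?U = "{zs \<in> words n {0..2 * int L}. (\<Sum>z\<leftarrow>zs. nat z) = a + b}"
  have fin: "finite ?U" by (simp add: finite_words)
  have "digit_sum_set L n a + digit_sum_set L n b \<subseteq> digit_value (2 * int L + 1) ` ?U"
  proof
    fix z assume "z \<in> digit_sum_set L n a + digit_sum_set L n b"
    then obtain xs ys where xs: "xs \<in> words n {0..int L}" "(\<Sum>x\<leftarrow>xs. nat x) = a"
      and ys: "ys \<in> words n {0..int L}" "(\<Sum>y\<leftarrow>ys. nat y) = b"
      and z: "z = digit_value (2 * int L + 1) xs + digit_value (2 * int L + 1) ys"
      by (auto simp: digit_sum_set_def set_plus_def)
    have len: "length xs = length ys" using xs ys by (simp add: words_def)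
    have "map2 (+) xs ys \<in> ?U"
    proof -
      have "\<forall>x\<in>set xs. 0 \<le> x" "\<forall>y\<in>set ys. 0 \<le> y" using xs ys by (auto simp: words_def)
      then have "(\<Sum>z\<leftarrow>map2 (+) xs ys. nat z) = a + b"
        using sum_list_nat_add[OF len] xs ys by simp
      moreover have "x + y \<in> {0..2 * int L}" if "(x, y) \<in> set (zip xs ys)" for x y
        using set_zip_leftD[OF that] set_zip_rightD[OF that] xs ys by (fastforce simp: words_def)
      ultimately show ?thesis using xs len by (auto simp: words_def)
    qed
    then show "z \<in> digit_value (2 * int L + 1) ` ?U"
      unfolding z digit_value_add[OF len, symmetric] by blast
  qed
  then have "card (digit_sum_set L n a + digit_sum_set L n b) \<le> card ?U"
    using fin by (rule surj_card_le[rotated])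
  then have "real (card (digit_sum_set L n a + digit_sum_set L n b)) * r ^ (a + b)
      \<le> real (card ?U) * r ^ (a + b)"
    using assms by (intro mult_right_mono) auto
  also have "\<dots> \<le> (\<Sum>z\<in>{0..2 * int L}. r ^ nat z) ^ n"
    using assms by (intro card_words_weight_le) auto
  also have "(\<Sum>z\<in>{0..2 * int L}. r ^ nat z) = (\<Sum>j=0..2*L. r ^ j)"
    by (rule sum.reindex_bij_witness[of _ int nat]) auto
  finally show ?thesis .
qed

text \<open>These encode the differences \<open>x - y\<close> in which \<open>x\<close> and
  \<open>y\<close> have no common position with nonzero digits.\<close>

definition signed_words :: "nat \<Rightarrow> nat \<Rightarrow> nat \<Rightarrow> nat \<Rightarrow> int list set"
  where "signed_words L n a b =
    {ws \<in> words n {- int L..int L}. (\<Sum>w\<leftarrow>ws. nat w) = a \<and> (\<Sum>w\<leftarrow>ws. nat (- w)) = b}"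

text \<open>Splitting a word into positive and negative parts exhibits its value as a difference,
  and balanced expansions are unique.\<close>

lemma card_signed_words_le:
  "card (signed_words L n a b) \<le> card (diffset (digit_sum_set L n a) (digit_sum_set L n b))"
proof -
  let ?v = "digit_value (2 * int L + 1)"
  have "?v ` signed_words L n a b \<subseteq> diffset (digit_sum_set L n a) (digit_sum_set L n b)"
  proof
    fix z assume "z \<in> ?v ` signed_words L n a b"
    then obtain ws where ws: "ws \<in> signed_words L n a b" "z = ?v ws" by auto
    let ?p = "map (max 0) ws" and ?q = "map (\<lambda>w. max 0 (- w)) ws"
    have "z = ?v ?p - ?v ?q" using ws digit_value_diff_parts by simp
    moreover have "(\<lambda>w. nat (max 0 w)) = nat" "(\<lambda>w. nat (max 0 (- w))) = (\<lambda>w. nat (- w))"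
      by auto
    then have "?v ?p \<in> digit_sum_set L n a" "?v ?q \<in> digit_sum_set L n b"
      using ws(1) unfolding digit_sum_set_def
      by (fastforce simp: signed_words_def words_def o_def intro!: imageI)+
    ultimately show "z \<in> diffset (digit_sum_set L n a) (digit_sum_set L n b)"
      by (auto simp: diffset_def)
  qed
  moreover have "finite (diffset (digit_sum_set L n a) (digit_sum_set L n b))"
    by (intro finite_diffset) (simp_all add: digit_sum_set_def finite_words)
  moreover have "inj_on ?v (signed_words L n a b)"
    by (rule inj_on_subset[OF inj_on_digit_value[of L n]]) (auto simp: signed_words_def)
  ultimately show ?thesis by (metis card_image card_mono)
qed

text \<open>Pigeonhole over the at most \<open>(n L + 1)\<^sup>2\<close> pairs of digit sums.\<close>

lemma many_signed_words:
  fixes r :: real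
  assumes "r > 0"
  obtains a b where "signed_words L n a b \<noteq> {}"
    "(1 + 2 * (\<Sum>j=1..L. r ^ j)) ^ n
      \<le> real (n * L + 1) ^ 2 * (real (card (signed_words L n a b)) * r ^ (a + b))"
proof -
  let ?W = "words n {- int L..int L}" and ?I = "{..n * L} \<times> {..n * L}"
  let ?f = "\<lambda>(a, b). real (card (signed_words L n a b)) * r ^ (a + b)"
  let ?Z = "1 + 2 * (\<Sum>j=1..L. r ^ j)"
  \<comment> \<open>The coefficient 2 counts the two signs of a nonzero digit.\<close>
  have "?Z = (\<Sum>w\<in>{- int L..int L}. r ^ nat \<bar>w\<bar>)"
  proof -
    have "{- int L..int L} = {0} \<union> ({1..int L} \<union> {- int L..-1})" by auto
    then have "(\<Sum>w\<in>{- int L..int L}. r ^ nat \<bar>w\<bar>) =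
        1 + ((\<Sum>w\<in>{1..int L}. r ^ nat \<bar>w\<bar>) + (\<Sum>w\<in>{- int L..-1}. r ^ nat \<bar>w\<bar>))"
      by (simp add: sum.union_disjoint)
    moreover have "(\<Sum>w\<in>{1..int L}. r ^ nat \<bar>w\<bar>) = (\<Sum>j=1..L. r ^ j)"
      by (rule sum.reindex_bij_witness[of _ int nat]) auto
    moreover have "(\<Sum>w\<in>{- int L..-1}. r ^ nat \<bar>w\<bar>) = (\<Sum>j=1..L. r ^ j)"
      by (rule sum.reindex_bij_witness[of _ "\<lambda>j. - int j" "\<lambda>w. nat (- w)"]) auto
    ultimately show ?thesis by simp
  qed
  then have "?Z ^ n = (\<Sum>ws\<in>?W. r ^ (\<Sum>w\<leftarrow>ws. nat \<bar>w\<bar>))"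
    by (simp add: sum_power_weight_words)
  also have "\<dots> = (\<Sum>p\<in>?I. \<Sum>ws | ws \<in> ?W \<and> ((\<Sum>w\<leftarrow>ws. nat w), (\<Sum>w\<leftarrow>ws. nat (- w))) = p.
      r ^ (\<Sum>w\<leftarrow>ws. nat \<bar>w\<bar>))"
    using sum_list_nat_le by (intro sum.group[symmetric] finite_words) (auto simp: words_def)
  also have "\<dots> = (\<Sum>p\<in>?I. ?f p)"
    by (intro sum.cong refl) (auto simp: signed_words_def sum_list_nat_abs)
  finally have Z: "?Z ^ n = (\<Sum>p\<in>?I. ?f p)" .
  have "\<exists>p\<in>?I. ?Z ^ n / real (n * L + 1) ^ 2 \<le> ?f p"
  proof (rule ccontr)
    assume "\<not> ?thesis"
    then have "?f p < ?Z ^ n / real (n * L + 1) ^ 2" if "p \<in> ?I" for p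
      using that by (meson not_le)
    then have "(\<Sum>p\<in>?I. ?f p) < (\<Sum>p\<in>?I. ?Z ^ n / real (n * L + 1) ^ 2)"
      by (intro sum_strict_mono) blast+
    also have "(\<Sum>p\<in>?I. c) = real (n * L + 1) ^ 2 * c" for c
      by (simp add: card_cartesian_product power2_eq_square algebra_simps)
    also have "real (n * L + 1) ^ 2 * (?Z ^ n / real (n * L + 1) ^ 2) = ?Z ^ n"
    proof -
      have "real (n * L + 1) \<noteq> 0" by linarith
      then show ?thesis by (simp del: of_nat_add of_nat_mult)
    qed
    finally show False using Z by simp
  qed
  then obtain a b where ab: "?Z ^ n / real (n * L + 1) ^ 2 \<le> ?f (a, b)" by blast
  have "?Z > 0" using assms by (simp add: add_pos_nonneg sum_nonneg)
  moreover have "real (n * L + 1) > 0" by linarith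
  ultimately have "?Z ^ n / real (n * L + 1) ^ 2 > 0" by (intro divide_pos_pos zero_less_power)
  then have "signed_words L n a b \<noteq> {}" using ab by (auto simp del: of_nat_add of_nat_mult)
  moreover have "?Z ^ n \<le> real (n * L + 1) ^ 2 * ?f (a, b)"
    using ab by (simp add: pos_divide_le_eq mult.commute del: of_nat_add of_nat_mult)
  ultimately show thesis using that by auto
qed

text \<open>The hypothesis makes \<open>\<rho> = ZD / (q * ZS)\<close> exceed 1, so
  \<open>\<rho> ^ n\<close> eventually outweighs the polynomial pigeonhole loss \<open>P\<close>.
  Since \<open>q ^ n = m powr (\<theta> - 1)\<close> for \<open>m = (2 * L + 1) ^ n\<close>, this is
  the gain that \<open>admissible_exponentI\<close> requires.\<close>

lemma admissible_exponent_generating_functions: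
  fixes r \<theta> :: real and L :: nat
  assumes K: "K > 1" and \<theta>: "\<theta> > 1" and L: "L > 0" and r: "r > 0"
    and ineq: "real (2 * L + 1) powr (\<theta> - 1) * (\<Sum>j=0..2*L. r ^ j) < 1 + 2 * (\<Sum>j=1..L. r ^ j)"
  shows "admissible_exponent K \<theta>"
proof (rule admissible_exponentI[OF K \<theta>])
  fix N :: nat
  define ZS ZD q where "ZS = (\<Sum>j=0..2*L. r ^ j)" and "ZD = 1 + 2 * (\<Sum>j=1..L. r ^ j)"
    and "q = real (2 * L + 1) powr (\<theta> - 1)"
  have ZS: "ZS > 0" unfolding ZS_def using r by (intro sum_pos) auto
  have q: "q > 0" by (simp add: q_def)
  define \<rho> where "\<rho> = ZD / (q * ZS)"
  have \<rho>: "\<rho> > 1" using ineq ZS q by (simp add: \<rho>_def ZS_def ZD_def q_def)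
  have "filterlim (\<lambda>n. \<rho> ^ n / (real n * real L + 1) ^ 2) at_top sequentially"
    using \<rho> L by real_asymp
  then have "eventually (\<lambda>n. \<rho> ^ n / (real n * real L + 1) ^ 2 \<ge> 1) sequentially"
    by (simp add: filterlim_at_top)
  moreover have "eventually (\<lambda>n. n \<ge> N) sequentially" by (rule eventually_ge_at_top)
  ultimately have "eventually (\<lambda>n. n \<ge> N \<and> \<rho> ^ n / (real n * real L + 1) ^ 2 \<ge> 1) sequentially"
    by eventually_elim simp
  then obtain n where n: "n \<ge> N" "\<rho> ^ n / (real n * real L + 1) ^ 2 \<ge> 1"
    using eventually_happens' sequentially_bot by blast
  define P where "P = real (n * L + 1) ^ 2"
  have P: "P > 0" unfolding P_def by (intro zero_less_power) linarith
  have PZ: "P * (q ^ n * ZS ^ n) \<le> ZD ^ n"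
  proof -
    have "P \<le> \<rho> ^ n" using n(2) P by (simp add: P_def add.commute)
    then have "P * (q * ZS) ^ n \<le> \<rho> ^ n * (q * ZS) ^ n"
      using q ZS by (intro mult_right_mono) auto
    also have "\<dots> = ZD ^ n" using q ZS by (simp add: \<rho>_def flip: power_mult_distrib)
    finally show ?thesis by (simp add: power_mult_distrib)
  qed
  obtain a b where ab: "signed_words L n a b \<noteq> {}"
    "ZD ^ n \<le> P * (real (card (signed_words L n a b)) * r ^ (a + b))"
    by (rule many_signed_words[OF r, of L n, folded ZD_def P_def])
  let ?X = "digit_sum_set L n a" and ?Y = "digit_sum_set L n b"
  let ?m = "(2 * L + 1) ^ n"
  have "finite (signed_words L n a b)" by (simp add: signed_words_def finite_words)
  then have "card (diffset ?X ?Y) > 0"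
    using ab(1) card_signed_words_le[of L n a b] by (metis card_gt_0_iff gr_zeroI leD)
  then have ne: "?X \<noteq> {}" "?Y \<noteq> {}" by (auto simp: diffset_def)
  have "q ^ n = real ?m powr (\<theta> - 1)"
    by (simp add: q_def powr_power powr_powr mult.commute powr_realpow[symmetric]
        del: of_nat_Suc of_nat_add)
  moreover have "real (card (?X + ?Y)) * q ^ n \<le> real (card (diffset ?X ?Y))"
  proof -
    \<comment> \<open>The pigeonhole leaves \<open>a\<close> and \<open>b\<close> unspecified, but
      both counting bounds carry the same factor \<open>r ^ (a + b)\<close>, which cancels at the
      end.\<close>
    have "P * r ^ (a + b) * (real (card (?X + ?Y)) * q ^ n)
        = P * q ^ n * (real (card (?X + ?Y)) * r ^ (a + b))" by simp
    also have "\<dots> \<le> P * q ^ n * ZS ^ n"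
      unfolding ZS_def using P q r by (intro mult_left_mono card_digit_sum_set_plus) auto
    also have "\<dots> \<le> ZD ^ n" using PZ by (simp add: mult.assoc)
    also have "\<dots> \<le> P * r ^ (a + b) * real (card (signed_words L n a b))"
      using ab(2) by (simp add: mult_ac)
    also have "\<dots> \<le> P * r ^ (a + b) * real (card (diffset ?X ?Y))"
      using P r card_signed_words_le by (intro mult_left_mono) auto
    finally show ?thesis using P r by (simp add: mult_le_cancel_left_pos)
  qed
  moreover have "?m \<ge> N"
  proof -
    have "n < 2 ^ n" by (rule less_exp)
    also have "(2::nat) ^ n \<le> ?m" using L by (intro power_mono) auto
    finally show ?thesis using n(1) by linarith
  qed
  ultimately show "\<exists>m\<ge>N. \<exists>X Y. X \<subseteq> {0..<int m} \<and> Y \<subseteq> {0..<int m} \<and> X \<noteq> {} \<and> Y \<noteq> {} \<and>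
      real (card (X + Y)) * real m powr (\<theta> - 1) \<le> real (card (diffset X Y))"
    using ne digit_sum_set_subset by (intro exI[of _ ?m] conjI exI[of _ ?X] exI[of _ ?Y]) auto
qed

section \<open>The numerical exponent\<close>

text \<open>Writing 11 as \<open>2 ^ 3 * (11 / 8)\<close> keeps the arguments close to 1, where the
  logarithm series converges fast.\<close>

lemma ln_11_less: "ln (11 :: real) < 239789529 / 100000000"
proof -
  have "ln (2 :: real) \<le> 693147182 / 1000000000"
    using ln_approx_bounds[of 2 8] by (simp add: eval_nat_numeral)
  moreover have "ln (11 / 8 :: real) \<le> 318453733 / 1000000000"
    using ln_approx_bounds[of "11/8" 6] by (simp add: eval_nat_numeral)
  moreover have "ln (11 :: real) = 3 * ln 2 + ln (11 / 8)"
    using ln_realpow[of 2 3] by (simp add: ln_div)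
  ultimately show ?thesis by linarith
qed

text \<open>The bound 1.5144026 is a rational separating this power from the ratio of the two
  generating functions for \<open>L = 5\<close> at \<open>r = 62 / 99\<close>.\<close>

lemma powr_11_less: "(11 :: real) powr 0.173077 < 1.5144026"
proof -
  have "ln (15144026 / 10000000 :: real) \<ge> 415020888 / 1000000000"
    using ln_approx_bounds[of "15144026 / 10000000" 6] by (simp add: eval_nat_numeral)
  then have "173077 / 1000000 * ln 11 < ln (15144026 / 10000000 :: real)"
    using ln_11_less by linarith
  then have "exp (173077 / 1000000 * ln 11) < exp (ln (15144026 / 10000000 :: real))"
    by (simp only: exp_less_cancel_iff)
  then show ?thesis by (simp add: powr_def)
qed

theorem theorem1:
  fixes K :: real
  assumes "K > 1"
  shows "theta_star K \<ge> 1.173077"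
proof (rule le_theta_star, rule admissible_exponent_generating_functions[OF assms, of _ 5 "62/99"])
  have "(11 :: real) powr 0.173077 * (\<Sum>j=0..10. (62/99) ^ j) < 1.5144026 * (\<Sum>j=0..10. (62/99) ^ j)"
    using powr_11_less by (intro mult_strict_right_mono) (simp_all add: sum_pos)
  \<comment> \<open>Only rational arithmetic remains once the sums are expanded.\<close>
  also have "\<dots> < 1 + 2 * (\<Sum>j=1..5. (62/99) ^ j)"
    by (simp add: eval_nat_numeral)
  finally show "real (2 * 5 + 1) powr (1.173077 - 1) * (\<Sum>j=0..2*5. (62/99) ^ j)
      < 1 + 2 * (\<Sum>j=1..5. (62/99 :: real) ^ j)"
    by simp
qed simp_all

end
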